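(* Over an alphabet containing at least three distinct characters, there exists an infinite family of strings $T = aS$ (with $a$ a character, of unboundedly large length and size $\mathsf{e}(T)$) such that $\mathsf{e}(S) - \mathsf{e}(T) = \mathsf{e}(T) - 4$. Consequently the worst-case additive sensitivity of the CDAWG size under left-end deletion is at least $\mathsf{e}-4$.
   Context: Strings are finite sequences of characters from an alphabet $\Sigma$; $\varepsilon$ is the empty string. For a string $T$, $\mathrm{Substr}(T)$ is its set of substrings (including $\varepsilon$). A substring $u$ of $T$ is left-maximal in $T$ if $u$ is a prefix of $T$ or there are distinct characters $c \neq d$ with $cu, du \in \mathrm{Substr}(T)$; it is right-maximal in $T$ if $u$ is a suffix of $T$ or there are distinct characters $c\neq d$ with $uc, ud \in \mathrm{Substr}(T)$. $\mathsf{M}(T)$ is the set of substrings of $T$ that are both left- and right-maximal (it contains $\varepsilon$ and $T$). The compact directed acyclic word graph $\mathrm{CDAWG}(T)$ has exactly one node for each element of $\mathsf{M}(T)$, and the outgoing edges of the node $x$ are in bijection with the characters $c$ such that $xc \in \mathrm{Substr}(T)$. For a string $w$, $d_T(w)$ is the number of distinct characters $c$ with $wc \in \mathrm{Substr}(T)$. The size of the CDAWG is $\mathsf{e}(T) = \sum_{x \in \mathsf{M}(T)} d_T(x)$, its number of edges. *)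

theory Defs
  imports Complex_Main "HOL-Library.Sublist" "HOL-Library.Extended_Real"
begin

definition Substr :: "'a list \<Rightarrow> 'a list set" where
  "Substr T = {u. sublist u T}"

definition left_maximal :: "'a list \<Rightarrow> 'a list \<Rightarrow> bool" where
  "left_maximal T u \<longleftrightarrow> u \<in> Substr T \<and>
     (prefix u T \<or> (\<exists>c d. c \<noteq> d \<and> c # u \<in> Substr T \<and> d # u \<in> Substr T))"

definition right_maximal :: "'a list \<Rightarrow> 'a list \<Rightarrow> bool" where
  "right_maximal T u \<longleftrightarrow> u \<in> Substr T \<and>
     (suffix u T \<or> (\<exists>c d. c \<noteq> d \<and> u @ [c] \<in> Substr T \<and> u @ [d] \<in> Substr T))"

definition maximal_substrs :: "'a list \<Rightarrow> 'a list set" where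
  "maximal_substrs T = {u. left_maximal T u \<and> right_maximal T u}"

definition right_degree :: "'a list \<Rightarrow> 'a list \<Rightarrow> nat" where
  "right_degree T w = card {c. w @ [c] \<in> Substr T}"

definition cdawg_size :: "'a list \<Rightarrow> nat" where
  "cdawg_size T = (\<Sum>x\<in>maximal_substrs T. right_degree T x)"

text \<open>
  Worst-case additive sensitivity of the CDAWG size under deletion of the leftmost character,
  over the nonempty strings on the alphabet \<open>\<Sigma>\<close>: as a function of the string length \<open>n\<close>, and as a
  function of the CDAWG size \<open>k\<close> before the deletion. The suprema are taken in the extended reals
  so that they are meaningful without a prior boundedness argument when \<open>\<Sigma>\<close> is infinite.
\<close>

definition left_deletion_sensitivity :: "'a set \<Rightarrow> nat \<Rightarrow> ereal" where
  "left_deletion_sensitivity \<Sigma> n =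
     Sup {ereal (real (cdawg_size S) - real (cdawg_size (a # S))) | a S.
            a # S \<in> lists \<Sigma> \<and> length (a # S) = n}"

definition left_deletion_sensitivity_by_size :: "'a set \<Rightarrow> nat \<Rightarrow> ereal" where
  "left_deletion_sensitivity_by_size \<Sigma> k =
     Sup {ereal (real (cdawg_size S) - real (cdawg_size (a # S))) | a S.
            a # S \<in> lists \<Sigma> \<and> cdawg_size (a # S) = k}"

end

theory Submission
  imports Defs
begin

text \<open>
  The family is \<open>T = (ab)\<^sup>m c (ab)\<^sup>m\<close> with \<open>m \<ge> 1\<close>. A substring containing the unique \<open>c\<close> is maximal only
  if it is the whole word, so the nodes apart from the sink are alternating words over \<open>a, b\<close>.
  In \<open>T\<close> every occurrence of \<open>b(ab)\<^sup>i\<close> is preceded by \<open>a\<close>, and the nodes are the \<open>(ab)\<^sup>i\<close> with \<open>i \<le> m\<close>,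
  giving \<open>2m + 2\<close> edges. Deleting the leading \<open>a\<close> turns every \<open>b(ab)\<^sup>i\<close> with \<open>i < m\<close> into a prefix and
  hence into a new node, while \<open>(ab)\<^sup>i\<close> with \<open>i < m\<close> stays left-maximal because it is preceded
  by both \<open>b\<close> and \<open>c\<close> (or, for \<open>i = 0\<close>, is empty); this gives \<open>4m = 2(2m + 2) - 4\<close> edges.
\<close>

section \<open>Alternating words\<close>

text \<open>Swapping the letters in the recursion lets one function cover both starting letters and
  both parities: \<open>(ab)^i\<close> is \<open>alt a b (2 * i)\<close> and \<open>b(ab)^i\<close>
  is \<open>alt b a (Suc (2 * i))\<close>.\<close>

fun alt :: "'a \<Rightarrow> 'a \<Rightarrow> nat \<Rightarrow> 'a list" where
  "alt x y 0 = []"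
| "alt x y (Suc n) = x # alt y x n"

lemma length_alt [simp]: "length (alt x y n) = n"
  by (induction n arbitrary: x y) auto

lemma alt_eq_Nil_iff [simp]: "alt x y n = [] \<longleftrightarrow> n = 0"
  by (cases n) auto

lemma set_alt_subset: "set (alt x y n) \<subseteq> {x, y}"
  by (induction n arbitrary: x y) (simp, fastforce)

lemma alt_snoc: "alt x y n @ [if even n then x else y] = alt x y (Suc n)"
  by (induction n arbitrary: x y) auto

lemma take_alt: "take k (alt x y n) = alt x y (min k n)"
proof (induction n arbitrary: x y k)
  case (Suc n)
  then show ?case by (cases k) auto
qed simp

lemma drop_alt:
  "drop k (alt x y n) = (if even k then alt x y (n - k) else alt y x (n - k))"
proof (induction n arbitrary: x y k)
  case (Suc n)
  then show ?case by (cases k) auto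
qed simp

lemma alt_inject [simp]: "alt x y i = alt x y j \<longleftrightarrow> i = j"
  by (metis length_alt)

lemma alt_eq_alt_swap_iff:
  assumes "x \<noteq> y"
  shows "alt x y i = alt y x j \<longleftrightarrow> i = 0 \<and> j = 0"
  using assms by (cases i; cases j) auto

lemma prefix_alt_iff: "prefix u (alt x y n) \<longleftrightarrow> (\<exists>k\<le>n. u = alt x y k)"
proof
  assume "prefix u (alt x y n)"
  then have "u = take (length u) (alt x y n)" "length u \<le> n"
    by (auto simp: prefix_def dest: arg_cong[of _ _ length])
  then show "\<exists>k\<le>n. u = alt x y k"
    by (metis min.cobounded2 take_alt)
next
  assume "\<exists>k\<le>n. u = alt x y k"
  then show "prefix u (alt x y n)"
    by (metis min.absorb1 take_alt take_is_prefix)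
qed

text \<open>The suffix of length \<open>k\<close> starts at position \<open>n - k\<close>, whose
  parity decides the first letter.\<close>

lemma suffix_alt_iff:
  "suffix u (alt x y n) \<longleftrightarrow> (\<exists>k\<le>n. u = (if even (n - k) then alt x y k else alt y x k))"
proof
  assume "suffix u (alt x y n)"
  then obtain v where v: "alt x y n = v @ u" by (auto simp: suffix_def)
  then have "n = length v + length u"
    by (metis length_alt length_append)
  moreover have "u = drop (length v) (alt x y n)" by (simp add: v)
  ultimately show "\<exists>k\<le>n. u = (if even (n - k) then alt x y k else alt y x k)"
    by (intro exI[of _ "length u"]) (simp add: drop_alt)
next
  assume "\<exists>k\<le>n. u = (if even (n - k) then alt x y k else alt y x k)"
  then obtain k where "k \<le> n" "u = (if even (n - k) then alt x y k else alt y x k)" by blast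
  then have "u = drop (n - k) (alt x y n)" by (simp add: drop_alt)
  then show "suffix u (alt x y n)" by (simp add: suffix_drop)
qed

text \<open>A substring is a prefix of a suffix. The second bound is strict because at most
  \<open>n - 1\<close> letters remain from an odd position on.\<close>

lemma sublist_alt_iff:
  "sublist u (alt x y n) \<longleftrightarrow> (\<exists>k\<le>n. u = alt x y k) \<or> (\<exists>k<n. u = alt y x k)"
proof -
  have "sublist u (alt x y n) \<longleftrightarrow> (\<exists>v. prefix u v \<and> suffix v (alt x y n))"
    by (auto simp: sublist_altdef')
  also have "\<dots> \<longleftrightarrow> (\<exists>k\<le>n. u = alt x y k) \<or> (\<exists>k<n. u = alt y x k)"
  proof
    assume "\<exists>v. prefix u v \<and> suffix v (alt x y n)"
    then obtain k where k: "k \<le> n" "prefix u (if even (n - k) then alt x y k else alt y x k)"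
      by (auto simp: suffix_alt_iff)
    show "(\<exists>k\<le>n. u = alt x y k) \<or> (\<exists>k<n. u = alt y x k)"
    proof (cases "even (n - k)")
      case True
      with k show ?thesis by (auto simp: prefix_alt_iff)
    next
      case False
      with k have "k < n" by (cases "k = n") auto
      with False k show ?thesis by (auto simp: prefix_alt_iff)
    qed
  next
    assume "(\<exists>k\<le>n. u = alt x y k) \<or> (\<exists>k<n. u = alt y x k)"
    then show "\<exists>v. prefix u v \<and> suffix v (alt x y n)"
    proof
      assume "\<exists>k\<le>n. u = alt x y k"
      then have "prefix u (alt x y n)" by (simp add: prefix_alt_iff)
      then show ?thesis by blast
    next
      assume "\<exists>k<n. u = alt y x k"
      then obtain k where "k < n" "u = alt y x k" by blast
      then have "prefix u (alt y x (n - 1))" "suffix (alt y x (n - 1)) (alt x y n)"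
        by (auto simp: prefix_alt_iff suffix_alt_iff intro!: exI[of _ "n - 1"])
      then show ?thesis by blast
    qed
  qed
  finally show ?thesis .
qed

section \<open>Comparisons of two alternating words as length and parity conditions\<close>

context
  fixes x y :: 'a
  assumes xy: "x \<noteq> y"
begin

lemma prefix_alt_same: "prefix (alt x y j) (alt x y n) \<longleftrightarrow> j \<le> n"
  by (auto simp: prefix_alt_iff)

lemma prefix_alt_swap: "prefix (alt x y j) (alt y x n) \<longleftrightarrow> j = 0"
  using xy by (auto simp: prefix_alt_iff alt_eq_alt_swap_iff)

lemma suffix_alt_same: "suffix (alt x y j) (alt x y n) \<longleftrightarrow> j = 0 \<or> j \<le> n \<and> even (n - j)"
proof
  assume "suffix (alt x y j) (alt x y n)"
  then obtain k where "k \<le> n"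
    "alt x y j = (if even (n - k) then alt x y k else alt y x k)"
    unfolding suffix_alt_iff by blast
  then show "j = 0 \<or> j \<le> n \<and> even (n - j)"
    by (cases "even (n - k)") (simp_all add: alt_eq_alt_swap_iff[OF xy])
next
  assume "j = 0 \<or> j \<le> n \<and> even (n - j)"
  then show "suffix (alt x y j) (alt x y n)"
  proof
    assume "j \<le> n \<and> even (n - j)"
    then show ?thesis
      unfolding suffix_alt_iff by (intro exI[of _ j]) auto
  qed simp
qed

lemma suffix_alt_swap: "suffix (alt x y j) (alt y x n) \<longleftrightarrow> j = 0 \<or> j \<le> n \<and> odd (n - j)"
proof
  assume "suffix (alt x y j) (alt y x n)"
  then obtain k where "k \<le> n"
    "alt x y j = (if even (n - k) then alt y x k else alt x y k)"
    unfolding suffix_alt_iff by blast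
  then show "j = 0 \<or> j \<le> n \<and> odd (n - j)"
    by (cases "even (n - k)") (simp_all add: alt_eq_alt_swap_iff[OF xy])
next
  assume "j = 0 \<or> j \<le> n \<and> odd (n - j)"
  then show "suffix (alt x y j) (alt y x n)"
  proof
    assume "j \<le> n \<and> odd (n - j)"
    then show ?thesis
      unfolding suffix_alt_iff by (intro exI[of _ j]) auto
  qed simp
qed

lemma sublist_alt_same: "sublist (alt x y j) (alt x y n) \<longleftrightarrow> j \<le> n"
  using xy by (auto simp: sublist_alt_iff alt_eq_alt_swap_iff)

lemma sublist_alt_swap: "sublist (alt x y j) (alt y x n) \<longleftrightarrow> j = 0 \<or> j < n"
  using xy by (auto simp: sublist_alt_iff alt_eq_alt_swap_iff)

end

text \<open>\<open>0 < j\<close> fixes the first letter of the extended word. The extension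
  \<open>[e]\<close> of the empty word can start with either letter; that case is left to
  \<open>singleton_sublist_Y0\<close>.\<close>

lemma alt_snoc_eq_alt_iff:
  assumes "x \<noteq> y" "0 < j"
  shows "alt x y j @ [e] = alt x y k \<longleftrightarrow> e = (if even j then x else y) \<and> k = Suc j"
    and "alt x y j @ [e] \<noteq> alt y x k"
proof -
  show "alt x y j @ [e] = alt x y k \<longleftrightarrow> e = (if even j then x else y) \<and> k = Suc j"
  proof (cases "k = Suc j")
    case True
    have "alt x y k = alt x y j @ [if even j then x else y]"
      unfolding True by (rule alt_snoc[symmetric])
    with True show ?thesis by simp
  next
    case False
    then show ?thesis by (auto dest: arg_cong[of _ _ length])
  qed
  show "alt x y j @ [e] \<noteq> alt y x k"
    using assms by (cases j; cases k) auto
qed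

lemma Cons_alt_eq_alt_iff:
  assumes "x \<noteq> y" "0 < j"
  shows "e # alt x y j = alt y x k \<longleftrightarrow> e = y \<and> k = Suc j"
    and "e # alt x y j \<noteq> alt x y k"
  using assms by (cases k; auto simp: alt_eq_alt_swap_iff)+

lemma sublist_alt_snoc:
  assumes "x \<noteq> y" "0 < j"
  shows "sublist (alt x y j @ [e]) (alt x y n) \<longleftrightarrow> e = (if even j then x else y) \<and> j < n"
    and "sublist (alt x y j @ [e]) (alt y x n) \<longleftrightarrow> e = (if even j then x else y) \<and> Suc j < n"
  using assms by (auto simp: sublist_alt_iff alt_snoc_eq_alt_iff)

lemma sublist_Cons_alt:
  assumes "x \<noteq> y" "0 < j"
  shows "sublist (e # alt x y j) (alt x y n) \<longleftrightarrow> e = y \<and> Suc j < n"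
    and "sublist (e # alt x y j) (alt y x n) \<longleftrightarrow> e = y \<and> j < n"
  using assms by (auto simp: sublist_alt_iff Cons_alt_eq_alt_iff)

section \<open>Words with a separator\<close>

text \<open>By \<open>suffix X Y\<close>, every substring of \<open>X\<close> also occurs in
  \<open>Y\<close>. The instances are the full word, with \<open>X = Y\<close>, and its tail, where
  \<open>X\<close> is \<open>Y\<close> without its first letter.\<close>

locale separated_word =
  fixes X Y :: "'a list" and c :: 'a
  assumes suffix_XY: "suffix X Y" and c_notin: "c \<notin> set Y"
begin

abbreviation W :: "'a list" where "W \<equiv> X @ c # Y"

lemma c_notin_X: "c \<notin> set X"
  using suffix_XY c_notin set_mono_suffix by fastforce

lemma separator_split:
  assumes "p @ c # q = X @ c # Y"
  shows "p = X \<and> q = Y"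
  using assms c_notin c_notin_X
  by (auto simp: append_eq_append_conv2 append_eq_Cons_conv Cons_eq_append_conv)

text \<open>Since \<open>c\<close> occurs only once in \<open>W\<close>, every occurrence must align
  its \<open>c\<close> with that one.\<close>

lemma Substr_separator_iff: "u @ c # v \<in> Substr W \<longleftrightarrow> suffix u X \<and> prefix v Y"
proof
  assume "u @ c # v \<in> Substr W"
  then obtain p q where "p @ (u @ c # v) @ q = W"
    by (auto simp: Substr_def sublist_def)
  then have "(p @ u) @ c # (v @ q) = X @ c # Y" by simp
  from separator_split[OF this] show "suffix u X \<and> prefix v Y" by (auto simp: suffix_def)
next
  assume "suffix u X \<and> prefix v Y"
  then obtain p q where "X = p @ u" "Y = v @ q" by (auto simp: suffix_def prefix_def)
  then have "W = p @ (u @ c # v) @ q" by simp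
  then show "u @ c # v \<in> Substr W" unfolding Substr_def sublist_def by blast
qed

lemma Substr_free_iff:
  assumes "c \<notin> set u"
  shows "u \<in> Substr W \<longleftrightarrow> sublist u Y"
proof
  assume "u \<in> Substr W"
  \<comment> \<open>The straddling case collapses: a nonempty \<open>u2\<close> would begin with
    \<open>c\<close>, so \<open>u = u1\<close> is a suffix of \<open>X\<close>.\<close>
  then have "sublist u X \<or> sublist u (c # Y) \<or>
      (\<exists>u1 u2. u = u1 @ u2 \<and> suffix u1 X \<and> prefix u2 (c # Y))"
    by (simp add: Substr_def sublist_append)
  moreover have "sublist u Y" if "sublist u X"
    using that suffix_XY by (meson suffix_imp_sublist sublist_order.order_trans)
  ultimately show "sublist u Y"
    using assms by (auto simp: sublist_Cons_right prefix_Cons)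
next
  assume "sublist u Y"
  then show "u \<in> Substr W"
    by (simp add: Substr_def sublist_append sublist_Cons_right)
qed

section \<open>One-letter extensions, maximality and degree in \<open>W\<close>\<close>

lemma snoc_Substr_iff:
  assumes "c \<notin> set u"
  shows "u @ [e] \<in> Substr W \<longleftrightarrow> (if e = c then suffix u X else sublist (u @ [e]) Y)"
  using assms Substr_separator_iff[of u "[]"] Substr_free_iff[of "u @ [e]"] by auto

lemma Cons_Substr_iff:
  assumes "c \<notin> set u"
  shows "e # u \<in> Substr W \<longleftrightarrow> (if e = c then prefix u Y else sublist (e # u) Y)"
  using assms Substr_separator_iff[of "[]" u] Substr_free_iff[of "e # u"] by auto

lemma suffix_W_iff:
  assumes "c \<notin> set u"
  shows "suffix u W \<longleftrightarrow> suffix u Y"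
  using assms by (auto simp: suffix_append suffix_Cons)

lemma prefix_W_iff:
  assumes "c \<notin> set u"
  shows "prefix u W \<longleftrightarrow> prefix u X"
  using assms by (auto simp: prefix_append prefix_Cons)

text \<open>A substring through the separator occurs only once, so it has at most one neighbouring
  letter on each side. Maximality then forces it to reach both ends of \<open>W\<close>.\<close>

lemma maximal_with_separator_iff:
  assumes "c \<in> set u"
  shows "u \<in> maximal_substrs W \<longleftrightarrow> u = W"
proof
  assume u: "u \<in> maximal_substrs W"
  obtain p q where pq: "u = p @ c # q" using assms by (meson split_list)
  have "prefix u W"
  proof -
    have "d = e" if "d # u \<in> Substr W" "e # u \<in> Substr W" for d e
      using that Substr_separator_iff[of "_ # p" q] pq
      by (auto simp: suffix_def)
    then show ?thesis using u by (auto simp: maximal_substrs_def left_maximal_def)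
  qed
  moreover have "suffix u W"
  proof -
    have "d = e" if "u @ [d] \<in> Substr W" "u @ [e] \<in> Substr W" for d e
      using that Substr_separator_iff[of p "q @ [_]"] pq
      by (auto simp: prefix_def)
    then show ?thesis using u by (auto simp: maximal_substrs_def right_maximal_def)
  qed
  ultimately obtain q' p' where q': "W = u @ q'" and p': "W = p' @ u"
    by (auto simp: prefix_def suffix_def)
  have "p = X"
    using separator_split[of p "q @ q'"] q' pq by simp
  moreover have "q = Y"
    using separator_split[of "p' @ p" q] p' pq by simp
  ultimately show "u = W" by (simp add: pq)
next
  assume "u = W"
  then show "u \<in> maximal_substrs W"
    by (simp add: maximal_substrs_def left_maximal_def right_maximal_def Substr_def)
qed

lemma right_degree_W: "right_degree W W = 0"
proof -
  have "W @ [d] \<notin> Substr W" for d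
    by (auto simp: Substr_def dest: sublist_length_le)
  then show ?thesis by (simp add: right_degree_def)
qed

text \<open>The only node containing \<open>c\<close> is the sink \<open>W\<close>, which has no
  outgoing edges and drops out of the sum.\<close>

lemma cdawg_size_W:
  "cdawg_size W = (\<Sum>u\<in>{u \<in> maximal_substrs W. c \<notin> set u}. right_degree W u)"
proof -
  have "finite (maximal_substrs W)"
    by (rule finite_subset[OF _ finite_set[of "sublists W"]])
      (auto simp: maximal_substrs_def left_maximal_def Substr_def)
  then show ?thesis
    unfolding cdawg_size_def
    by (intro sum.mono_neutral_right) (auto simp: maximal_with_separator_iff right_degree_W)
qed

text \<open>The letter \<open>c\<close> precedes \<open>u\<close> exactly when \<open>u\<close> is a
  prefix of \<open>Y\<close>, and follows it exactly when \<open>u\<close> is a suffix of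
  \<open>X\<close>. So each side offers three ways: an end of \<open>W\<close>, \<open>c\<close>
  together with another letter, or two letters inside \<open>Y\<close>.\<close>

lemma maximal_free_iff:
  assumes "c \<notin> set u"
  shows "u \<in> maximal_substrs W \<longleftrightarrow> sublist u Y \<and>
    (prefix u X \<or> (\<exists>d. d \<noteq> c \<and> sublist (d # u) Y \<and> prefix u Y) \<or>
      (\<exists>d e. d \<noteq> e \<and> sublist (d # u) Y \<and> sublist (e # u) Y)) \<and>
    (suffix u Y \<or> (\<exists>d. d \<noteq> c \<and> sublist (u @ [d]) Y \<and> suffix u X) \<or>
      (\<exists>d e. d \<noteq> e \<and> sublist (u @ [d]) Y \<and> sublist (u @ [e]) Y))"
proof -
  have "d \<noteq> c" if "sublist (d # u) Y \<or> sublist (u @ [d]) Y" for d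
    using that c_notin by (auto simp: sublist_def)
  then show ?thesis
    using assms
    by (simp add: maximal_substrs_def left_maximal_def right_maximal_def Substr_free_iff
        snoc_Substr_iff Cons_Substr_iff suffix_W_iff prefix_W_iff)
     (smt (verit))
qed

lemma right_degree_free:
  assumes "c \<notin> set u"
  shows "right_degree W u = (if suffix u X then 1 else 0) + card {e. sublist (u @ [e]) Y}"
proof -
  have *: "c \<notin> {e. sublist (u @ [e]) Y}"
    using c_notin by (auto simp: sublist_def)
  have fin: "finite {e. sublist (u @ [e]) Y}"
    by (rule finite_subset[of _ "set Y"]) (auto simp: sublist_def)
  have "{e. u @ [e] \<in> Substr W} = (if suffix u X then {c} else {}) \<union> {e. sublist (u @ [e]) Y}"
    using assms * by (auto simp: snoc_Substr_iff split: if_splits)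
  then show ?thesis using * fin by (simp add: right_degree_def)
qed

end

section \<open>The words $(ab)^m c (ab)^m$ and $b(ab)^{m-1} c (ab)^m$\<close>

lemma Nil_maximal: "[] \<in> maximal_substrs w"
  by (auto simp: maximal_substrs_def left_maximal_def right_maximal_def Substr_def)

text \<open>This is the degree sum of the nodes \<open>(ab)^i\<close> with \<open>i < m\<close>,
  common to both words; only the empty word has three outgoing edges.\<close>

lemma sum_three_twos: "0 < k \<Longrightarrow> (\<Sum>i<k. if i = 0 then 3 else 2) = 2 * k + (1::nat)"
  by (induction k rule: nat_induct_non_zero) auto

context
  fixes a b c :: 'a and m :: nat
  assumes ab: "a \<noteq> b" and ac: "a \<noteq> c" and bc: "b \<noteq> c" and m: "0 < m"
begin

abbreviation Y0 :: "'a list" where "Y0 \<equiv> alt a b (2 * m)"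
abbreviation X1 :: "'a list" where "X1 \<equiv> alt b a (2 * m - Suc 0)"

lemma c_notin_alt: "c \<notin> set (alt a b k)" "c \<notin> set (alt b a k)"
  using set_alt_subset[of a b k] set_alt_subset[of b a k] ac bc by auto

lemma separated_full: "separated_word Y0 Y0 c"
  by unfold_locales (auto simp: c_notin_alt)

lemma separated_tail: "separated_word X1 Y0 c"
  using ab m by unfold_locales (auto simp: c_notin_alt suffix_alt_swap)

lemmas alt_facts = c_notin_alt
  prefix_alt_same[OF ab] prefix_alt_same[OF ab[symmetric]]
  prefix_alt_swap[OF ab] prefix_alt_swap[OF ab[symmetric]]
  suffix_alt_same[OF ab] suffix_alt_same[OF ab[symmetric]]
  suffix_alt_swap[OF ab] suffix_alt_swap[OF ab[symmetric]]
  sublist_alt_same[OF ab] sublist_alt_same[OF ab[symmetric]]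
  sublist_alt_swap[OF ab] sublist_alt_swap[OF ab[symmetric]]
  sublist_alt_snoc[OF ab] sublist_alt_snoc[OF ab[symmetric]]
  sublist_Cons_alt[OF ab] sublist_Cons_alt[OF ab[symmetric]]

section \<open>The nodes of the two words\<close>

lemma singleton_sublist_Y0: "sublist [e] Y0 \<longleftrightarrow> e = a \<or> e = b"
  using m sublist_alt_same[OF ab, of 1 "2 * m"] sublist_alt_swap[OF ab[symmetric], of 1 "2 * m"]
    c_notin_alt set_alt_subset[of a b "2 * m"]
  by (auto dest!: set_mono_sublist[of "[e]"])

text \<open>Even words starting with \<open>a\<close> are both prefixes and suffixes of
  \<open>Y0\<close>. Odd ones are always followed by \<open>b\<close>, because \<open>Y0\<close>
  ends in \<open>b\<close>; words starting with \<open>b\<close> are always preceded by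
  \<open>a\<close>.\<close>

lemma maximal_full_alt:
  assumes "0 < k"
  shows "alt a b k \<in> maximal_substrs (Y0 @ c # Y0) \<longleftrightarrow> k \<le> 2 * m \<and> even k"
    and "alt b a k \<notin> maximal_substrs (Y0 @ c # Y0)"
proof -
  interpret separated_word Y0 Y0 c by (rule separated_full)
  show "alt a b k \<in> maximal_substrs (Y0 @ c # Y0) \<longleftrightarrow> k \<le> 2 * m \<and> even k"
    using assms ab ac bc m by (auto simp: maximal_free_iff alt_facts)
  show "alt b a k \<notin> maximal_substrs (Y0 @ c # Y0)"
    using assms ab ac bc m by (auto simp: maximal_free_iff alt_facts)
qed

text \<open>\<open>(ab)^m\<close> is lost, as its only occurrence is preceded by \<open>c\<close>;
  shorter even words are preceded by both \<open>b\<close> and \<open>c\<close>. Words starting with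
  \<open>b\<close> are now prefixes of \<open>X1\<close>, and those of even length fail only because
  \<open>b\<close> always follows them.\<close>

lemma maximal_tail_alt:
  assumes "0 < k"
  shows "alt a b k \<in> maximal_substrs (X1 @ c # Y0) \<longleftrightarrow> k < 2 * m \<and> even k"
    and "alt b a k \<in> maximal_substrs (X1 @ c # Y0) \<longleftrightarrow> k < 2 * m \<and> odd k"
proof -
  interpret separated_word X1 Y0 c by (rule separated_tail)
  show "alt a b k \<in> maximal_substrs (X1 @ c # Y0) \<longleftrightarrow> k < 2 * m \<and> even k"
    using assms ab ac bc m by (auto simp: maximal_free_iff alt_facts)
  show "alt b a k \<in> maximal_substrs (X1 @ c # Y0) \<longleftrightarrow> k < 2 * m \<and> odd k"
    using assms ab ac bc m by (auto simp: maximal_free_iff alt_facts)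
qed

lemma maximal_full:
  "{u \<in> maximal_substrs (Y0 @ c # Y0). c \<notin> set u} = (\<lambda>i. alt a b (2 * i)) ` {..m}"
    (is "?L = ?R")
proof
  interpret separated_word Y0 Y0 c by (rule separated_full)
  show "?L \<subseteq> ?R"
  proof
    fix u
    assume u: "u \<in> ?L"
    then have "sublist u Y0" by (auto simp: maximal_free_iff)
    then obtain k where "u = alt a b k \<or> u = alt b a k" by (auto simp: sublist_alt_iff)
    with u have "\<exists>k\<le>2 * m. even k \<and> u = alt a b k"
      by (cases "k = 0") (auto simp: maximal_full_alt)
    then show "u \<in> ?R" by (auto elim!: evenE)
  qed
  have "alt a b (2 * i) \<in> ?L" if "i \<le> m" for i
    using that by (cases "i = 0") (auto simp: maximal_full_alt c_notin_alt Nil_maximal)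
  then show "?R \<subseteq> ?L" by blast
qed

lemma maximal_tail:
  "{u \<in> maximal_substrs (X1 @ c # Y0). c \<notin> set u} =
    (\<lambda>i. alt a b (2 * i)) ` {..<m} \<union> (\<lambda>i. alt b a (Suc (2 * i))) ` {..<m}"
    (is "?L = ?A \<union> ?B")
proof
  interpret separated_word X1 Y0 c by (rule separated_tail)
  show "?L \<subseteq> ?A \<union> ?B"
  proof
    fix u
    assume u: "u \<in> ?L"
    then have "sublist u Y0" by (auto simp: maximal_free_iff)
    then obtain k where "u = alt a b k \<or> u = alt b a k" by (auto simp: sublist_alt_iff)
    then consider "u = []" | "0 < k" "u = alt a b k" | "0 < k" "u = alt b a k" by fastforce
    then show "u \<in> ?A \<union> ?B"
    proof cases
      case 1
      \<comment> \<open>The empty word is filed under \<open>?A\<close> at index 0, which exists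
        since \<open>m\<close> is positive.\<close>
      with m have "u = alt a b (2 * 0)" "0 < m" by auto
      then show ?thesis by blast
    next
      case 2
      with u have "k < 2 * m" "even k" by (auto simp: maximal_tail_alt)
      with 2 have "u = alt a b (2 * (k div 2))" "k div 2 < m" by auto
      then show ?thesis by blast
    next
      case 3
      with u have "k < 2 * m" "odd k" by (auto simp: maximal_tail_alt)
      with 3 have "u = alt b a (Suc (2 * (k div 2)))" "k div 2 < m" by auto
      then show ?thesis by blast
    qed
  qed
  have "alt a b (2 * i) \<in> ?L" if "i < m" for i
    using that by (cases "i = 0") (auto simp: maximal_tail_alt c_notin_alt Nil_maximal)
  moreover have "alt b a (Suc (2 * i)) \<in> ?L" if "i < m" for i
    using that maximal_tail_alt(2)[of "Suc (2 * i)"] c_notin_alt(2)[of "Suc (2 * i)"] by simp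
  ultimately show "?A \<union> ?B \<subseteq> ?L" by blast
qed

section \<open>Degrees and edge counts\<close>

lemma card_right_extensions_Nil: "card {e. sublist [e] Y0} = 2"
proof -
  have "{e. sublist [e] Y0} = {a, b}" by (auto simp: singleton_sublist_Y0)
  then show ?thesis using ab by simp
qed

text \<open>\<open>(ab)^i\<close> is followed by \<open>c\<close> at the separator and by
  \<open>a\<close> unless \<open>i = m\<close>; the empty word is also followed by
  \<open>b\<close>.\<close>

lemma right_degree_full:
  "right_degree (Y0 @ c # Y0) (alt a b (2 * i)) = (if i = 0 then 3 else if i < m then 2 else 1)"
  if "i \<le> m"
proof -
  interpret separated_word Y0 Y0 c by (rule separated_full)
  show ?thesis
    using that card_right_extensions_Nil by (auto simp: right_degree_free alt_facts)
qed

text \<open>\<open>b(ab)^i\<close> is followed by \<open>c\<close> at the separator and by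
  \<open>a\<close>, except that for \<open>i = m - 1\<close> it is all of \<open>X1\<close> and no
  \<open>a\<close> can follow.\<close>

lemma right_degree_tail:
  assumes "i < m"
  shows "right_degree (X1 @ c # Y0) (alt a b (2 * i)) = (if i = 0 then 3 else 2)"
    and "right_degree (X1 @ c # Y0) (alt b a (Suc (2 * i))) = (if Suc i = m then 1 else 2)"
proof -
  interpret separated_word X1 Y0 c by (rule separated_tail)
  show "right_degree (X1 @ c # Y0) (alt a b (2 * i)) = (if i = 0 then 3 else 2)"
    using assms card_right_extensions_Nil by (auto simp: right_degree_free alt_facts)
  have "Suc (2 * i) \<le> 2 * m - Suc 0" "even (2 * m - Suc 0 - Suc (2 * i))"
    "Suc (Suc (2 * i)) < 2 * m \<longleftrightarrow> Suc i \<noteq> m"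
    using assms by auto
  then show "right_degree (X1 @ c # Y0) (alt b a (Suc (2 * i))) = (if Suc i = m then 1 else 2)"
    by (simp add: right_degree_free alt_facts del: alt.simps)
qed

lemma cdawg_size_full: "cdawg_size (Y0 @ c # Y0) = 2 * m + 2"
proof -
  interpret separated_word Y0 Y0 c by (rule separated_full)
  have "cdawg_size (Y0 @ c # Y0) = (\<Sum>i\<le>m. if i = 0 then 3 else if i < m then 2 else 1)"
    by (simp add: cdawg_size_W maximal_full sum.reindex inj_on_def right_degree_full)
  \<comment> \<open>The last node \<open>(ab)^m\<close> is followed by \<open>c\<close> only and
    gives the summand 1.\<close>
  also have "\<dots> = (\<Sum>i<m. if i = 0 then 3 else 2) + 1"
    using m by (auto simp: lessThan_Suc_atMost[symmetric] intro: sum.cong)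
  finally show ?thesis using m by (simp add: sum_three_twos)
qed

lemma cdawg_size_tail: "cdawg_size (X1 @ c # Y0) = 4 * m"
proof -
  interpret separated_word X1 Y0 c by (rule separated_tail)
  let ?A = "(\<lambda>i. alt a b (2 * i)) ` {..<m}" and ?B = "(\<lambda>i. alt b a (Suc (2 * i))) ` {..<m}"
  have "?A \<inter> ?B = {}"
    using alt_eq_alt_swap_iff[OF ab] by (auto simp del: alt.simps)
  then have "cdawg_size (X1 @ c # Y0) =
      sum (right_degree (X1 @ c # Y0)) ?A + sum (right_degree (X1 @ c # Y0)) ?B"
    unfolding cdawg_size_W maximal_tail by (intro sum.union_disjoint) auto
  also have "sum (right_degree (X1 @ c # Y0)) ?A = (\<Sum>i<m. if i = 0 then 3 else 2)"
    by (simp add: sum.reindex inj_on_def right_degree_tail)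
  also have "sum (right_degree (X1 @ c # Y0)) ?B = (\<Sum>i<m. if Suc i = m then 1 else 2)"
    by (simp add: sum.reindex inj_on_def right_degree_tail del: alt.simps)
  \<comment> \<open>The node \<open>X1\<close>, at \<open>i = m - 1\<close>, contributes 1 and the
    other \<open>m - 1\<close> nodes contribute 2 each.\<close>
  also have "(\<Sum>i<m. if Suc i = m then 1 else 2) = 2 * m - (1::nat)"
    using m by (cases m) auto
  finally show ?thesis using m by (simp add: sum_three_twos)
qed

lemma full_eq_Cons_tail: "Y0 @ c # Y0 = a # X1 @ c # Y0"
  using m by (cases m) auto

end

section \<open>The infinite family and its sensitivity bounds\<close>

theorem theorem4:
  fixes \<Sigma> :: "'a set"
  assumes "\<exists>x\<in>\<Sigma>. \<exists>y\<in>\<Sigma>. \<exists>z\<in>\<Sigma>. x \<noteq> y \<and> x \<noteq> z \<and> y \<noteq> z"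
  shows "\<exists>F \<subseteq> lists \<Sigma>.
    infinite F \<and>
    (\<forall>N. \<exists>T\<in>F. N \<le> length T \<and> N \<le> cdawg_size T) \<and>
    (\<forall>T\<in>F. \<exists>a S. T = a # S \<and>
       int (cdawg_size S) - int (cdawg_size T) = int (cdawg_size T) - 4) \<and>
    (\<forall>T\<in>F.
       left_deletion_sensitivity \<Sigma> (length T) \<ge> ereal (real (cdawg_size T) - 4) \<and>
       left_deletion_sensitivity_by_size \<Sigma> (cdawg_size T) \<ge> ereal (real (cdawg_size T) - 4))"
proof -
  obtain a b c where abc: "a \<in> \<Sigma>" "b \<in> \<Sigma>" "c \<in> \<Sigma>" "a \<noteq> b" "a \<noteq> c" "b \<noteq> c"
    using assms by blast
  define S where "S m = alt b a (2 * m - Suc 0) @ c # alt a b (2 * m)" for m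
  define F where "F = (\<lambda>m. a # S m) ` {0<..}"
  have size_S: "cdawg_size (S m) = 4 * m"
    and size_T: "cdawg_size (a # S m) = 2 * m + 2" if "0 < m" for m
    using cdawg_size_tail[OF abc(4-6) that] cdawg_size_full[OF abc(4-6) that]
      full_eq_Cons_tail[OF abc(4-6) that]
    by (simp_all add: S_def)
  have in_lists: "a # S m \<in> lists \<Sigma>" for m
    using abc set_alt_subset[of a b "2 * m"] set_alt_subset[of b a "2 * m - Suc 0"]
    by (auto simp: S_def)
  have large: "\<forall>N. \<exists>T\<in>F. N \<le> length T \<and> N \<le> cdawg_size T"
  proof
    fix N
    show "\<exists>T\<in>F. N \<le> length T \<and> N \<le> cdawg_size T"
      \<comment> \<open>At \<open>m = Suc N\<close> the word has length \<open>4 * N + 5\<close> and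
        size \<open>2 * N + 4\<close>.\<close>
      by (rule bexI[of _ "a # S (Suc N)"]) (auto simp: F_def size_T, simp add: S_def)
  qed
  have "infinite F"
  proof
    assume "finite F"
    then have "finite (length ` F)" by simp
    then obtain N where "\<forall>l\<in>length ` F. l < N" using finite_nat_set_iff_bounded by blast
    with large show False by (meson imageI not_less)
  qed
  moreover have
    "int (cdawg_size (S m)) - int (cdawg_size (a # S m)) = int (cdawg_size (a # S m)) - 4"
    if "0 < m" for m
    using that by (simp add: size_S size_T)
  moreover have "left_deletion_sensitivity \<Sigma> (length (a # S m)) \<ge> ereal (real (cdawg_size (a # S m)) - 4)"
      "left_deletion_sensitivity_by_size \<Sigma> (cdawg_size (a # S m)) \<ge> ereal (real (cdawg_size (a # S m)) - 4)"
    if "0 < m" for m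
  proof -
    \<comment> \<open>Both sides equal \<open>2 * m - 2\<close>; the right-hand form exhibits the
      bound as a member of the set whose supremum is taken.\<close>
    have eq: "real (cdawg_size (a # S m)) - 4 = real (cdawg_size (S m)) - real (cdawg_size (a # S m))"
      using that by (simp add: size_S size_T)
    show "left_deletion_sensitivity \<Sigma> (length (a # S m)) \<ge> ereal (real (cdawg_size (a # S m)) - 4)"
      unfolding eq left_deletion_sensitivity_def using in_lists by (intro Sup_upper) blast
    show "left_deletion_sensitivity_by_size \<Sigma> (cdawg_size (a # S m)) \<ge> ereal (real (cdawg_size (a # S m)) - 4)"
      unfolding eq left_deletion_sensitivity_by_size_def using in_lists by (intro Sup_upper) blast
  qed
  moreover have "F \<subseteq> lists \<Sigma>"
    unfolding F_def using in_lists by blast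
  ultimately show ?thesis
    using large by (intro exI[of _ F]) (auto simp: F_def)
qed

end
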